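(* Let $\mathcal{P}$ be a finite nonempty set of real prices, let $d\ge 1$ and let $(\rho_0,\ldots,\rho_{d-1})$ be any cycle of distinct prices in $\mathcal{P}$. For any integer memory length $\ell\ge1$, there exists a reference-monotone gain function $g:\mathcal{P}^2\to\mathbb{R}$ for which the unique optimal price cycle (i.e. the unique maximizer of the objective value $J$ over all price cycles) is the one represented by the string $$\rho_0^{k(\rho_{d-1},\rho_0)}\,\rho_1^{k(\rho_0,\rho_1)}\cdots\rho_{d-1}^{k(\rho_{d-2},\rho_{d-1})},$$ where $k(r,p):=1+(\ell-1)\mathbb{1}(r<p)$, that is, $k(r,p)=\ell$ if $r<p$ and $k(r,p)=1$ otherwise.
   Context: A gain function $g:\mathcal{P}^2\to\mathbb{R}$, written $g(r,p)$ ($r$ = reference price, $p$ = offered price), is reference-monotone if for every fixed $p\in\mathcal{P}$, $g(r,p)$ is weakly increasing in $r\in\mathcal{P}$. A price cycle is a finite sequence $(\pi_0,\ldots,\pi_{c-1})\in\mathcal{P}^c$ with $c$ any positive integer (to be offered repeatedly forever). Its objective value (long-run average gain) is $$J(\pi_0,\ldots,\pi_{c-1})=\frac1c\sum_{t=0}^{c-1} g\Big(\min\{\pi_{(t-\ell)\bmod c},\ldots,\pi_{(t-1)\bmod c}\},\,\pi_t\Big),$$ where $c<\ell$ is allowed. Price cycles are represented by strings over the alphabet $\mathcal{P}$, with $p^k$ denoting the concatenation of $k$ copies of $p$. Strings that generate the same infinite periodic sequence up to a shift (i.e. that differ by cyclic rotation and/or by repetition of a whole string, such as $1222$, $2221$,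 $2212$, $12221222$) represent the same price cycle; uniqueness is understood with this identification. *)

theory Defs
  imports Complex_Main
begin

text \<open>
  The gain \<open>g r p\<close> has the reference price \<open>r\<close> as its first argument and the offered price \<open>p\<close>
  as its second. Functions on \<open>P\<^sup>2\<close> are represented by functions on all pairs of reals, of which
  only the values on \<open>P\<close> are ever constrained or used.
\<close>

definition reference_monotone :: "real set \<Rightarrow> (real \<Rightarrow> real \<Rightarrow> real) \<Rightarrow> bool" where
  "reference_monotone P g \<longleftrightarrow> (\<forall>p\<in>P. mono_on P (\<lambda>r. g r p))"

definition price_cycle :: "real set \<Rightarrow> real list \<Rightarrow> bool" where
  "price_cycle P \<pi> \<longleftrightarrow> \<pi> \<noteq> [] \<and> set \<pi> \<subseteq> P"

text \<open>
  The entry of a string at a cyclic index. Indices are integers, so that looking back beyond the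
  start of the string wraps around; \<open>mod\<close> on \<open>int\<close> is nonnegative for a positive modulus.
  As a function of the index, this is the periodic sequence generated by a nonempty string.
\<close>

definition price_at :: "real list \<Rightarrow> int \<Rightarrow> real" where
  "price_at \<pi> t = \<pi> ! nat (t mod int (length \<pi>))"

text \<open>The case \<open>length \<pi> < l\<close> is included: the window then covers the whole string.\<close>

definition reference_price :: "nat \<Rightarrow> real list \<Rightarrow> int \<Rightarrow> real" where
  "reference_price l \<pi> t = Min (price_at \<pi> ` {t - int l .. t - 1})"

definition objective :: "nat \<Rightarrow> (real \<Rightarrow> real \<Rightarrow> real) \<Rightarrow> real list \<Rightarrow> real" where
  "objective l g \<pi> =
     (1 / real (length \<pi>)) *
     (\<Sum>t<length \<pi>. g (reference_price l \<pi> (int t)) (\<pi> ! t))"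

text \<open>
  Two nonempty strings represent the same price cycle if they generate the same periodic sequence
  up to a shift. Because the sequences are periodic, indexing them by all integers rather than by
  the natural numbers makes no difference.
\<close>

definition same_cycle :: "real list \<Rightarrow> real list \<Rightarrow> bool" where
  "same_cycle \<pi> \<sigma> \<longleftrightarrow> (\<exists>s. \<forall>t. price_at \<pi> t = price_at \<sigma> (t + s))"

definition optimal_cycle ::
    "real set \<Rightarrow> nat \<Rightarrow> (real \<Rightarrow> real \<Rightarrow> real) \<Rightarrow> real list \<Rightarrow> bool" where
  "optimal_cycle P l g \<pi> \<longleftrightarrow>
     price_cycle P \<pi> \<and> (\<forall>\<sigma>. price_cycle P \<sigma> \<longrightarrow> objective l g \<sigma> \<le> objective l g \<pi>)"

definition unique_optimal_cycle ::
    "real set \<Rightarrow> nat \<Rightarrow> (real \<Rightarrow> real \<Rightarrow> real) \<Rightarrow> real list \<Rightarrow> bool" where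
  "unique_optimal_cycle P l g \<pi> \<longleftrightarrow>
     optimal_cycle P l g \<pi> \<and> (\<forall>\<sigma>. optimal_cycle P l g \<sigma> \<longrightarrow> same_cycle \<sigma> \<pi>)"

definition repetitions :: "nat \<Rightarrow> real \<Rightarrow> real \<Rightarrow> nat" where
  "repetitions l r p = 1 + (l - 1) * of_bool (r < p)"

text \<open>
  Each price \<open>\<rho>\<^sub>i\<close> is repeated \<open>repetitions l \<rho>\<^sub>i\<^sub>-\<^sub>1 \<rho>\<^sub>i\<close> times, where the predecessor index is
  cyclic: the predecessor of the first price is the last one.
\<close>

definition expanded_cycle :: "nat \<Rightarrow> real list \<Rightarrow> real list" where
  "expanded_cycle l \<rho> =
     concat (map (\<lambda>i. replicate (repetitions l (price_at \<rho> (int i - 1)) (\<rho> ! i)) (\<rho> ! i))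
       [0..<length \<rho>])"

end

theory Submission
  imports Defs
begin

text \<open>
  Take the gain \<open>max (r - p) ((r - p) / l)\<close>, lowered by a small \<open>\<epsilon>\<close> unless \<open>p\<close> is the successor
  of \<open>r\<close> in \<open>\<rho>\<close>. The mean over \<open>j = 1, \<dots>, l\<close> of the minimum of the last \<open>j\<close> prices is a
  potential whose decrease bounds the unpenalised gain, so no cycle has a positive average; in the
  expanded cycle the block of \<open>\<rho>\<^sub>i\<close> contributes exactly \<open>\<rho>\<^sub>i\<^sub>-\<^sub>1 - \<rho>\<^sub>i\<close>, which telescopes to zero.
  An optimal cycle therefore never pays the penalty, so each offered price is determined by its
  reference price. Whenever the most recent price is the minimum of the window, that price alone
  determines the whole future; this happens after a global minimum of the optimal cycle, and after
  each block of the expanded cycle, so the two cycles synchronise.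
\<close>

section \<open>Windowed minima and the potential\<close>

text \<open>The window length is a parameter because the potential averages over all lengths up to
  \<open>l\<close>. For \<open>j = 0\<close> the minimum is unspecified, hence the side conditions
  \<open>j \<ge> 1\<close> below.\<close>

definition recent_min :: "(int \<Rightarrow> real) \<Rightarrow> int \<Rightarrow> nat \<Rightarrow> real" where
  "recent_min a t j = Min (a ` {t - int j .. t - 1})"

definition potential :: "nat \<Rightarrow> (int \<Rightarrow> real) \<Rightarrow> int \<Rightarrow> real" where
  "potential l a t = (\<Sum>j=1..l. recent_min a t j) / real l"

text \<open>For \<open>l \<ge> 1\<close> a price drop counts in full and a rise only with weight
  \<open>1 / l\<close>, so offering a higher price \<open>l\<close> times against the same reference
  costs the full difference.\<close>

definition base_gain :: "nat \<Rightarrow> real \<Rightarrow> real \<Rightarrow> real" where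
  "base_gain l r p = max (r - p) ((r - p) / real l)"

lemma reference_price_eq_recent_min:
  "reference_price l \<pi> t = recent_min (price_at \<pi>) t l"
  by (simp add: reference_price_def recent_min_def)

lemma recent_min_le:
  assumes "t - int j \<le> u" "u < t"
  shows "recent_min a t j \<le> a u"
  unfolding recent_min_def using assms by (intro Min_le) auto

lemma recent_min_ge:
  assumes "j \<ge> 1" "\<And>u. t - int j \<le> u \<Longrightarrow> u < t \<Longrightarrow> x \<le> a u"
  shows "x \<le> recent_min a t j"
  unfolding recent_min_def using assms by (intro Min.boundedI) auto

lemma recent_min_eqI:
  assumes "t - int j \<le> u" "u < t" "a u = x"
    and "\<And>v. t - int j \<le> v \<Longrightarrow> v < t \<Longrightarrow> x \<le> a v"
  shows "recent_min a t j = x"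
proof (rule antisym)
  show "recent_min a t j \<le> x" using recent_min_le[OF assms(1,2), of a] assms(3) by simp
  show "x \<le> recent_min a t j" using assms by (intro recent_min_ge) auto
qed

lemma recent_min_antimono:
  assumes "1 \<le> i" "i \<le> j"
  shows "recent_min a t j \<le> recent_min a t i"
  using assms by (intro recent_min_ge recent_min_le) auto

lemma recent_min_1 [simp]: "recent_min a t 1 = a (t - 1)"
  by (simp add: recent_min_def)

lemma recent_min_step:
  assumes "j \<ge> 1"
  shows "recent_min a (t + 1) (Suc j) = min (a t) (recent_min a t j)"
proof -
  have *: "{t + 1 - int (Suc j) .. t + 1 - 1} = insert t {t - int j .. t - 1}" by auto
  have "{t - int j .. t - 1} \<noteq> {}" using assms by auto
  then show ?thesis unfolding recent_min_def * by simp
qed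

lemma recent_min_periodic:
  assumes "\<And>u. a (u + c) = a u"
  shows "recent_min a (t + c) j = recent_min a t j"
proof -
  have *: "{t + c - int j .. t + c - 1} = (\<lambda>u. u + c) ` {t - int j .. t - 1}"
    by (simp add: algebra_simps)
  show ?thesis unfolding recent_min_def * image_image assms ..
qed

text \<open>Offering \<open>p\<close> turns the minimum of the last \<open>j\<close> prices into one
  over \<open>j + 1\<close> prices, capped by \<open>p\<close>. Hence \<open>l\<close> times the
  decrease is \<open>r - p + D\<close>, where \<open>D\<close> sums how far \<open>p\<close>
  undercuts the \<open>l - 1\<close> shorter minima. Now \<open>D \<ge> 0\<close> yields the piece
  \<open>(r - p) / l\<close>; and since every shorter minimum is at least \<open>r\<close>,
  \<open>D \<ge> (l - 1) * (r - p)\<close> yields the piece \<open>r - p\<close>.\<close>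

lemma base_gain_le_potential_decrease:
  assumes "l \<ge> 1"
  shows "base_gain l (recent_min a t l) (a t) \<le> potential l a t - potential l a (t + 1)"
proof -
  obtain m where l: "l = Suc m" using assms by (cases l) auto
  define r where "r = recent_min a t l"
  define p where "p = a t"
  define D where "D = (\<Sum>j=1..m. recent_min a t j - min p (recent_min a t j))"
  have old: "(\<Sum>j=1..l. recent_min a t j) = (\<Sum>j=1..m. recent_min a t j) + r"
    by (simp add: l r_def)
  have "(\<Sum>j=1..l. recent_min a (t + 1) j) = p + (\<Sum>j=Suc 1..Suc m. recent_min a (t + 1) j)"
    unfolding l by (subst sum.atLeast_Suc_atMost) (auto simp: p_def recent_min_1[unfolded One_nat_def])
  also have "(\<Sum>j=Suc 1..Suc m. recent_min a (t + 1) j) = (\<Sum>j=1..m. recent_min a (t + 1) (Suc j))"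
    by (rule sum.shift_bounds_cl_Suc_ivl)
  also have "\<dots> = (\<Sum>j=1..m. min p (recent_min a t j))"
    by (intro sum.cong refl) (simp add: recent_min_step p_def)
  finally have new: "(\<Sum>j=1..l. recent_min a (t + 1) j) = p + (\<Sum>j=1..m. min p (recent_min a t j))" .
  have "real l * (potential l a t - potential l a (t + 1))
      = (\<Sum>j=1..l. recent_min a t j) - (\<Sum>j=1..l. recent_min a (t + 1) j)"
    using assms by (simp add: potential_def right_diff_distrib)
  then have eq: "real l * (potential l a t - potential l a (t + 1)) = r - p + D"
    unfolding old new D_def sum_subtractf by simp
  have nonneg: "D \<ge> 0" unfolding D_def by (intro sum_nonneg) auto
  have "D \<ge> (\<Sum>j=1..m. r - p)"
    unfolding D_def
  proof (intro sum_mono)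
    fix j assume "j \<in> {1..m}"
    then have "r \<le> recent_min a t j" unfolding r_def by (intro recent_min_antimono) (auto simp: l)
    then show "r - p \<le> recent_min a t j - min p (recent_min a t j)" by linarith
  qed
  then have "real l * (r - p) \<le> r - p + D" by (simp add: l algebra_simps)
  then have "real l * (r - p) \<le> real l * (potential l a t - potential l a (t + 1))"
    using eq by simp
  then have "r - p \<le> potential l a t - potential l a (t + 1)" using assms by simp
  moreover have "(r - p) / real l \<le> potential l a t - potential l a (t + 1)"
    using eq nonneg assms by (simp add: divide_le_eq mult.commute)
  ultimately show ?thesis by (simp add: base_gain_def r_def p_def)
qed

text \<open>Both linear pieces have slope at least \<open>1 / l\<close> in the reference price. This
  slack later absorbs the penalty when monotonicity is checked.\<close>

lemma base_gain_increment:
  assumes "l \<ge> 1" "r \<le> s"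
  shows "base_gain l r p + (s - r) / real l \<le> base_gain l s p"
proof -
  have "(s - r) / real l \<le> s - r" using assms by (simp add: divide_le_eq mult_le_cancel_left1)
  moreover have "(s - p) / real l = (r - p) / real l + (s - r) / real l"
    by (simp add: diff_divide_distrib)
  ultimately show ?thesis by (simp add: base_gain_def max_def)
qed

text \<open>The number of repetitions is the reciprocal of the slope in force: \<open>1 / l\<close>
  for a rise, 1 otherwise.\<close>

lemma repetitions_mult_base_gain:
  assumes "l \<ge> 1"
  shows "real (repetitions l r p) * base_gain l r p = r - p"
proof (cases "r < p")
  case True
  have "real l * (r - p) \<le> 1 * (r - p)"
    using True assms by (intro mult_right_mono_neg) auto
  then have "(r - p) / real l \<ge> r - p" using assms by (simp add: le_divide_eq mult.commute)
  then show ?thesis using True assms by (simp add: repetitions_def base_gain_def max_def)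
next
  case False
  then have "(r - p) / real l \<le> r - p" using assms
    by (simp add: divide_le_eq mult_le_cancel_left1)
  then show ?thesis using False by (simp add: repetitions_def base_gain_def max_def)
qed

section \<open>Periodic sequences\<close>

lemma price_at_add_length [simp]: "price_at \<pi> (t + int (length \<pi>)) = price_at \<pi> t"
  by (simp add: price_at_def)

lemma price_at_add_mult_length [simp]: "price_at \<pi> (t + k * int (length \<pi>)) = price_at \<pi> t"
  by (simp add: price_at_def)

lemma price_at_nth: "t < length \<pi> \<Longrightarrow> price_at \<pi> (int t) = \<pi> ! t"
  by (simp add: price_at_def)

lemma price_at_in_set: "\<pi> \<noteq> [] \<Longrightarrow> price_at \<pi> t \<in> set \<pi>"
  by (simp add: price_at_def nat_less_iff)

lemma reference_price_add_length [simp]: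
  "reference_price l \<pi> (t + int (length \<pi>)) = reference_price l \<pi> t"
  by (simp add: reference_price_eq_recent_min recent_min_periodic)

text \<open>The potential differences telescope over one period, and the potential is
  periodic.\<close>

lemma sum_base_gain_nonpos:
  assumes "l \<ge> 1"
  shows "(\<Sum>t<length \<pi>. base_gain l (reference_price l \<pi> (int t)) (\<pi> ! t)) \<le> 0"
proof -
  let ?\<Phi> = "potential l (price_at \<pi>)"
  have "(\<Sum>t<length \<pi>. base_gain l (reference_price l \<pi> (int t)) (\<pi> ! t))
      \<le> (\<Sum>t<length \<pi>. ?\<Phi> (int t) - ?\<Phi> (int (Suc t)))"
  proof (intro sum_mono)
    fix t assume "t \<in> {..<length \<pi>}"
    then show "base_gain l (reference_price l \<pi> (int t)) (\<pi> ! t) \<le> ?\<Phi> (int t) - ?\<Phi> (int (Suc t))"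
      using base_gain_le_potential_decrease[OF assms, of "price_at \<pi>" "int t"]
      by (simp add: reference_price_eq_recent_min price_at_nth add.commute)
  qed
  also have "\<dots> = ?\<Phi> 0 - ?\<Phi> (0 + int (length \<pi>))"
    by (subst sum_lessThan_telescope') simp
  also have "\<dots> = 0"
    using recent_min_periodic[of "price_at \<pi>" "int (length \<pi>)" 0] by (simp add: potential_def)
  finally show ?thesis .
qed

text \<open>Agreement from some point onwards suffices, since any index can be moved forward by a
  common multiple of the two lengths.\<close>

lemma same_cycleI:
  assumes "\<pi> \<noteq> []" "\<sigma> \<noteq> []"
    and eq: "\<And>n. price_at \<pi> (t + int n) = price_at \<sigma> (u + int n)"
  shows "same_cycle \<pi> \<sigma>"
  unfolding same_cycle_def
proof (intro exI[of _ "u - t"] allI)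
  fix v
  \<comment> \<open>\<open>K * L\<close> is a multiple of both lengths and, as
    \<open>L \<ge> 1\<close>, at least \<open>t - v\<close>.\<close>
  define K where "K = \<bar>v - t\<bar>"
  define L where "L = int (length \<pi>) * int (length \<sigma>)"
  have "int (length \<pi>) \<ge> 1" "int (length \<sigma>) \<ge> 1" using assms(1,2) by (cases \<pi>; cases \<sigma>; simp)+
  then have "1 * 1 \<le> L" unfolding L_def by (intro mult_mono) auto
  then have "K * 1 \<le> K * L" by (intro mult_left_mono) (auto simp: K_def)
  then have nn: "v - t + K * L \<ge> 0" by (simp add: K_def)
  have "price_at \<pi> v = price_at \<pi> (v + (K * int (length \<sigma>)) * int (length \<pi>))"
    by (simp only: price_at_add_mult_length)
  also have "v + (K * int (length \<sigma>)) * int (length \<pi>) = t + int (nat (v - t + K * L))"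
    using nn by (simp add: L_def algebra_simps)
  also have "price_at \<pi> \<dots> = price_at \<sigma> (u + int (nat (v - t + K * L)))" by (rule eq)
  also have "u + int (nat (v - t + K * L)) = (v + (u - t)) + (K * int (length \<pi>)) * int (length \<sigma>)"
    using nn by (simp add: L_def algebra_simps)
  also have "price_at \<sigma> \<dots> = price_at \<sigma> (v + (u - t))" by (simp only: price_at_add_mult_length)
  finally show "price_at \<pi> v = price_at \<sigma> (v + (u - t))" .
qed

section \<open>Synchronisation at records\<close>

text \<open>
  While a price that is the minimum of its window stays visible, older prices cannot influence the
  reference price.
\<close>

lemma recent_min_after_record:
  assumes "l \<ge> 1" "recent_min a t l = a (t - 1)"
  shows "recent_min a (t + int n) l = Min ((\<lambda>i. a (t + i)) ` {max (- 1) (int n - int l) .. int n - 1})"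
    (is "_ = Min ?W")
proof (rule antisym)
  have "?W \<subseteq> a ` {t + int n - int l .. t + int n - 1}" using assms(1) by auto
  moreover have "?W \<noteq> {}" using assms(1) by auto
  ultimately show "recent_min a (t + int n) l \<le> Min ?W"
    unfolding recent_min_def by (intro Min_antimono) auto
  show "Min ?W \<le> recent_min a (t + int n) l"
  proof (rule recent_min_ge[OF assms(1)])
    fix u assume u: "t + int n - int l \<le> u" "u < t + int n"
    show "Min ?W \<le> a u"
    proof (cases "t - 1 \<le> u")
      case True
      then have "a (t + (u - t)) \<in> ?W" using u by (intro imageI) auto
      then show ?thesis by (intro Min_le) auto
    next
      \<comment> \<open>A window reaching back past \<open>t - 1\<close> contains the record at
        offset -1. The record bounds \<open>a u\<close> from below because \<open>u\<close> also
        lies in the window of length \<open>l\<close> before \<open>t\<close>.\<close>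
      case False
      then have "a (t + (-1)) \<in> ?W" using u by (intro imageI) auto
      then have "Min ?W \<le> a (t - 1)" by (intro Min_le) auto
      also have "\<dots> \<le> a u" using recent_min_le[of t l u a] assms(2) False u by simp
      finally show ?thesis .
    qed
  qed
qed

text \<open>\<open>E\<close> holds the admissible pairs of reference and offered price. By strong
  induction the parts of the two windows that matter agree, so the reference prices agree, and
  functionality of \<open>E\<close> forces the same next price.\<close>

lemma determined_by_record:
  assumes l: "l \<ge> 1"
    and functional: "\<And>r p q. (r, p) \<in> E \<Longrightarrow> (r, q) \<in> E \<Longrightarrow> p = q"
    and a: "\<And>v. (recent_min a v l, a v) \<in> E" and b: "\<And>v. (recent_min b v l, b v) \<in> E"
    and ra: "recent_min a t l = a (t - 1)" and rb: "recent_min b u l = b (u - 1)"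
    and eq: "a (t - 1) = b (u - 1)"
  shows "a (t + int n) = b (u + int n)"
proof (induction n rule: less_induct)
  case (less n)
  have "a (t + i) = b (u + i)" if "i \<in> {max (- 1) (int n - int l) .. int n - 1}" for i
  proof (cases "i = - 1")
    case True
    then show ?thesis using eq by simp
  next
    case False
    then show ?thesis using that less[of "nat i"] by auto
  qed
  then have "recent_min a (t + int n) l = recent_min b (u + int n) l"
    unfolding recent_min_after_record[OF l ra] recent_min_after_record[OF l rb]
    by (intro arg_cong[where f = Min] image_cong) auto
  then show ?case using a[of "t + int n"] b[of "u + int n"] functional by metis
qed

section \<open>The expanded cycle\<close>

lemma length_concat_replicate:
  "length (concat (map (\<lambda>i. replicate (k i) (f i)) [0..<n])) = (\<Sum>i<n. k i)"
  by (induction n) auto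

lemma nth_concat_replicate:
  assumes "i < n" "j < k i"
  shows "concat (map (\<lambda>i. replicate (k i) (f i)) [0..<n]) ! ((\<Sum>i'<i. k i') + j) = f i"
  using assms(1)
proof (induction n)
  case 0
  then show ?case by simp
next
  case (Suc n)
  show ?case
  proof (cases "i = n")
    case True
    then show ?thesis using assms(2) by (simp add: nth_append length_concat_replicate)
  next
    case False
    then have "i < n" using Suc.prems by simp
    have "(\<Sum>i'<i. k i') + j < (\<Sum>i'<Suc i. k i')" using assms(2) by simp
    also have "\<dots> \<le> (\<Sum>i'<n. k i')" using \<open>i < n\<close> by (intro sum_mono2) auto
    finally show ?thesis using Suc.IH[OF \<open>i < n\<close>] by (simp add: nth_append length_concat_replicate)
  qed
qed

lemma sum_blocks:
  fixes f :: "nat \<Rightarrow> 'a::comm_monoid_add" and n :: nat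
  shows "(\<Sum>t<(\<Sum>i<n. k i). f t) = (\<Sum>i<n. \<Sum>j<k i. f ((\<Sum>i'<i. k i') + j))"
proof (induction n)
  case 0
  then show ?case by simp
next
  case (Suc n)
  have split: "sum f {..<m + n'} = sum f {..<m} + (\<Sum>j<n'. f (m + j))" for m n'
    by (induction n') (auto simp: add.assoc)
  show ?case using Suc by (simp add: split)
qed

lemma exists_block:
  fixes t n :: nat
  assumes "t < (\<Sum>i<n. k i)"
  shows "\<exists>i<n. \<exists>j<k i. t = (\<Sum>i'<i. k i') + j"
  using assms
proof (induction n)
  case 0
  then show ?case by simp
next
  case (Suc n)
  show ?case
  proof (cases "t < (\<Sum>i<n. k i)")
    case True
    then show ?thesis using Suc.IH less_SucI by blast
  next
    case False
    then show ?thesis using Suc.prems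
      by (intro exI[of _ n] conjI exI[of _ "t - (\<Sum>i<n. k i)"]) auto
  qed
qed

section \<open>Records, reference prices and total gain in the expanded cycle\<close>

context
  fixes l :: nat and \<rho> :: "real list"
  assumes l: "l \<ge> 1" and \<rho>: "\<rho> \<noteq> []"
begin

text \<open>Blocks are numbered by all naturals, with \<open>\<rho>\<close> read periodically, so
  that arguments can move some periods ahead and look back from there.\<close>

definition block_length :: "nat \<Rightarrow> nat" where
  "block_length i = repetitions l (price_at \<rho> (int i - 1)) (price_at \<rho> (int i))"

definition block_start :: "nat \<Rightarrow> nat" where
  "block_start i = (\<Sum>i'<i. block_length i')"

lemma block_start_Suc: "block_start (Suc i) = block_start i + block_length i"
  by (simp add: block_start_def)

lemma block_length_bounds: "1 \<le> block_length i" "block_length i \<le> l"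
  using l by (auto simp: block_length_def repetitions_def of_bool_def)

lemma expanded_cycle_eq:
  "expanded_cycle l \<rho> =
     concat (map (\<lambda>i. replicate (block_length i) (price_at \<rho> (int i))) [0..<length \<rho>])"
  unfolding expanded_cycle_def block_length_def
  by (intro arg_cong[where f = concat] map_cong) (auto simp: price_at_nth)

lemma length_expanded_cycle: "length (expanded_cycle l \<rho>) = block_start (length \<rho>)"
  unfolding expanded_cycle_eq length_concat_replicate block_start_def ..

lemma expanded_cycle_not_Nil: "expanded_cycle l \<rho> \<noteq> []"
proof -
  obtain d where "length \<rho> = Suc d" using \<rho> by (cases \<rho>) auto
  then have "length (expanded_cycle l \<rho>) > 0"
    using block_length_bounds(1)[of d] by (simp add: length_expanded_cycle block_start_Suc)
  then show ?thesis by auto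
qed

lemma set_expanded_cycle: "set (expanded_cycle l \<rho>) \<subseteq> set \<rho>"
  unfolding expanded_cycle_eq using price_at_in_set[OF \<rho>] by auto

lemma block_length_periodic: "block_length (i + length \<rho>) = block_length i"
  using price_at_add_length[of \<rho> "int i"] price_at_add_length[of \<rho> "int i - 1"]
  by (simp add: block_length_def algebra_simps)

lemma block_start_periodic:
  "block_start (i + length \<rho>) = block_start i + length (expanded_cycle l \<rho>)"
  unfolding length_expanded_cycle
  by (induction i) (auto simp: block_start_Suc block_length_periodic, simp add: block_start_def)

lemma price_at_block:
  "j < block_length i \<Longrightarrow>
    price_at (expanded_cycle l \<rho>) (int (block_start i + j)) = price_at \<rho> (int i)"
proof (induction i rule: less_induct)
  case (less i)
  show ?case
  proof (cases "i < length \<rho>")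
    case True
    have "block_start i + j < block_start (Suc i)" using less.prems by (simp add: block_start_Suc)
    also have "\<dots> \<le> block_start (length \<rho>)"
      unfolding block_start_def using True by (intro sum_mono2) auto
    finally show ?thesis
      using nth_concat_replicate[of i "length \<rho>" j block_length "\<lambda>i. price_at \<rho> (int i)"] True
        less.prems
      by (simp only: price_at_nth length_expanded_cycle)
         (simp add: expanded_cycle_eq block_start_def)
  next
    case False
    then obtain h where h: "i = h + length \<rho>" by (metis add.commute le_add_diff_inverse not_less)
    then have "h < i" using \<rho> by simp
    then have "price_at (expanded_cycle l \<rho>) (int (block_start h + j)) = price_at \<rho> (int h)"
      using less by (simp add: h block_length_periodic)
    then show ?thesis
      using price_at_add_length[of "expanded_cycle l \<rho>" "int (block_start h + j)"]
      by (simp add: h block_start_periodic algebra_simps)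
  qed
qed

lemma price_at_before_block:
  "price_at (expanded_cycle l \<rho>) (int (block_start (Suc i)) - 1) = price_at \<rho> (int i)"
proof -
  have "int (block_start (Suc i)) - 1 = int (block_start i + (block_length i - 1))"
    using block_length_bounds(1)[of i] by (simp add: block_start_Suc)
  then show ?thesis
    using price_at_block[of "block_length i - 1" i] block_length_bounds(1)[of i] by simp
qed

text \<open>Induction from the block of a global minimum of \<open>\<rho>\<close>;
  \<open>i \<ge> length \<rho>\<close> ensures that one precedes block \<open>i\<close>. If a window
  reaches back beyond its last block, that block is shorter than \<open>l\<close>, so its price is
  not above the previous one and the bound for the previous block carries over.\<close>

lemma window_before_block:
  assumes "i \<ge> length \<rho>"
    and "int (block_start (Suc i)) - int l \<le> u" "u < int (block_start (Suc i))"
  shows "price_at \<rho> (int i) \<le> price_at (expanded_cycle l \<rho>) u"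
proof -
  obtain i0 where i0: "i0 < length \<rho>" "\<rho> ! i0 = Min (set \<rho>)"
    using \<rho> by (metis List.finite_set Min_in in_set_conv_nth set_empty)
  have "i0 \<le> i" using i0(1) assms(1) by simp
  then show ?thesis using assms(2,3)
  proof (induction i arbitrary: u rule: dec_induct)
    case base
    have "price_at (expanded_cycle l \<rho>) u \<in> set \<rho>"
      using price_at_in_set[OF expanded_cycle_not_Nil] set_expanded_cycle by blast
    then show ?case using i0 by (simp add: price_at_nth)
  next
    case (step i)
    show ?case
    proof (cases "u < int (block_start (Suc i))")
      case False
      define j where "j = nat (u - int (block_start (Suc i)))"
      have "u = int (block_start (Suc i) + j)" "j < block_length (Suc i)"
        using False step.prems by (auto simp: j_def block_start_Suc)
      then show ?thesis using price_at_block[of j "Suc i"] by (simp del: of_nat_Suc of_nat_add)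
    next
      case True
      then have "block_length (Suc i) < l" using step.prems by (simp add: block_start_Suc)
      then have "\<not> price_at \<rho> (int i) < price_at \<rho> (int (Suc i))"
        by (auto simp: block_length_def repetitions_def)
      moreover have "price_at \<rho> (int i) \<le> price_at (expanded_cycle l \<rho>) u"
        using True step.prems by (intro step.IH) (auto simp: block_start_Suc)
      ultimately show ?thesis by linarith
    qed
  qed
qed

text \<open>Supplies, for each price of \<open>\<rho>\<close>, a time at which that price is a
  record in the expanded cycle.\<close>

lemma record_before_block:
  assumes "i \<ge> length \<rho>"
  shows "recent_min (price_at (expanded_cycle l \<rho>)) (int (block_start (Suc i))) l = price_at \<rho> (int i)"
  using l price_at_before_block[of i] window_before_block[OF assms]
  by (intro recent_min_eqI[of _ _ "int (block_start (Suc i)) - 1"]) auto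

text \<open>The last price of the previous block stays visible, as a block has at most
  \<open>l\<close> entries. Older prices in the window are no lower, and earlier entries of the same
  block exist only after a rise, hence are higher.\<close>

lemma reference_price_block:
  assumes j: "j < block_length i"
  shows "reference_price l (expanded_cycle l \<rho>) (int (block_start i + j)) = price_at \<rho> (int i - 1)"
proof -
  let ?\<tau> = "expanded_cycle l \<rho>"
  \<comment> \<open>Two periods are added, not one, so that the predecessor index \<open>h\<close>
    is at least \<open>length \<rho>\<close> even for \<open>i = 0\<close>.\<close>
  obtain h where h: "i + 2 * length \<rho> = Suc h" "h \<ge> length \<rho>"
    using \<rho> by (cases "i + 2 * length \<rho>") (cases \<rho>; auto)+
  have start: "block_start (Suc h) = block_start i + 2 * length ?\<tau>"
    using block_start_periodic[of i] block_start_periodic[of "i + length \<rho>"] h(1)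
    by (simp add: mult_2 add.assoc)
  have len: "block_length (Suc h) = block_length i"
    using block_length_periodic[of i] block_length_periodic[of "i + length \<rho>"] h(1)
    by (simp add: mult_2 add.assoc)
  have "int h = int i - 1 + 2 * int (length \<rho>)" using h(1) by linarith
  then have prev: "price_at \<rho> (int h) = price_at \<rho> (int i - 1)"
    by (simp only: price_at_add_mult_length)
  have jl: "j < l" using j block_length_bounds(2)[of i] by simp
  have "reference_price l ?\<tau> (int (block_start (Suc h) + j)) = price_at \<rho> (int h)"
    unfolding reference_price_eq_recent_min
  proof (rule recent_min_eqI[of _ _ "int (block_start (Suc h)) - 1"])
    fix v assume v: "int (block_start (Suc h) + j) - int l \<le> v" "v < int (block_start (Suc h) + j)"
    show "price_at \<rho> (int h) \<le> price_at ?\<tau> v"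
    proof (cases "v < int (block_start (Suc h))")
      case True
      then show ?thesis using v by (intro window_before_block[OF h(2)]) auto
    next
      case False
      define j' where "j' = nat (v - int (block_start (Suc h)))"
      have j': "v = int (block_start (Suc h) + j')" "j' < j" using False v by (auto simp: j'_def)
      \<comment> \<open>The window already holds an entry of the same block, so the block has
        several entries and must follow a rise.\<close>
      then have "1 < block_length (Suc h)" using j len by simp
      then have "price_at \<rho> (int h) < price_at \<rho> (int (Suc h))"
        by (cases "price_at \<rho> (int h) < price_at \<rho> (int (Suc h))")
           (auto simp: block_length_def repetitions_def)
      moreover have "price_at ?\<tau> v = price_at \<rho> (int (Suc h))"
        unfolding j' using j' j len by (intro price_at_block) auto
      ultimately show ?thesis by simp
    qed
  qed (use jl price_at_before_block in auto)
  moreover have "reference_price l ?\<tau> (int (block_start (Suc h) + j))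
      = reference_price l ?\<tau> (int (block_start i + j) + int (length ?\<tau>) + int (length ?\<tau>))"
    by (rule arg_cong[where f = "reference_price l ?\<tau>"]) (simp add: start)
  ultimately show ?thesis using prev by (simp only: reference_price_add_length)
qed

text \<open>Only cyclic steps of \<open>\<rho>\<close> occur, so the expanded cycle will incur no
  penalty.\<close>

lemma expanded_cycle_transition:
  "\<exists>i<length \<rho>. reference_price l (expanded_cycle l \<rho>) t = price_at \<rho> (int i - 1) \<and>
     price_at (expanded_cycle l \<rho>) t = price_at \<rho> (int i)"
proof -
  let ?\<tau> = "expanded_cycle l \<rho>"
  define s where "s = nat (t mod int (length ?\<tau>))"
  have "length ?\<tau> > 0" using expanded_cycle_not_Nil by simp
  then have s: "int s = t mod int (length ?\<tau>)" "s < length ?\<tau>"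
    by (auto simp: s_def nat_less_iff)
  have t: "t = int s + (t div int (length ?\<tau>)) * int (length ?\<tau>)"
    using s(1) by simp
  obtain i j where ij: "i < length \<rho>" "j < block_length i" "s = block_start i + j"
    using exists_block[of s block_length "length \<rho>"] s(2)
    by (auto simp: length_expanded_cycle block_start_def)
  have "price_at ?\<tau> t = price_at ?\<tau> (int s)" by (subst t) (rule price_at_add_mult_length)
  moreover have "reference_price l ?\<tau> t = reference_price l ?\<tau> (int s)"
    unfolding reference_price_eq_recent_min
    by (subst t) (rule recent_min_periodic, rule price_at_add_mult_length)
  ultimately show ?thesis using ij price_at_block reference_price_block by metis
qed

lemma sum_base_gain_expanded_cycle:
  "(\<Sum>t<length (expanded_cycle l \<rho>).
      base_gain l (reference_price l (expanded_cycle l \<rho>) (int t)) (expanded_cycle l \<rho> ! t)) = 0"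
proof -
  let ?\<tau> = "expanded_cycle l \<rho>"
  let ?f = "\<lambda>t. base_gain l (reference_price l ?\<tau> (int t)) (price_at ?\<tau> (int t))"
  have "(\<Sum>t<length ?\<tau>. base_gain l (reference_price l ?\<tau> (int t)) (?\<tau> ! t))
      = (\<Sum>t<(\<Sum>i<length \<rho>. block_length i). ?f t)"
    by (intro sum.cong) (auto simp: price_at_nth length_expanded_cycle block_start_def)
  also have "\<dots> = (\<Sum>i<length \<rho>. \<Sum>j<block_length i. ?f (block_start i + j))"
    unfolding sum_blocks block_start_def ..
  also have "\<dots> = (\<Sum>i<length \<rho>. price_at \<rho> (int i - 1) - price_at \<rho> (int i))"
  proof (intro sum.cong refl)
    fix i
    have "(\<Sum>j<block_length i. ?f (block_start i + j))
        = (\<Sum>j<block_length i. base_gain l (price_at \<rho> (int i - 1)) (price_at \<rho> (int i)))"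
      by (intro sum.cong refl) (simp only: lessThan_iff price_at_block reference_price_block)
    then show "(\<Sum>j<block_length i. ?f (block_start i + j))
        = price_at \<rho> (int i - 1) - price_at \<rho> (int i)"
      using repetitions_mult_base_gain[OF l] by (simp add: block_length_def)
  qed
  also have "\<dots> = (\<Sum>i<length \<rho>. price_at \<rho> (int i - 1) - price_at \<rho> (int (Suc i) - 1))"
    by simp
  also have "\<dots> = price_at \<rho> (- 1) - price_at \<rho> (- 1 + int (length \<rho>))"
    using sum_lessThan_telescope'[of "\<lambda>i. price_at \<rho> (int i - 1)" "length \<rho>"] by simp
  also have "\<dots> = 0" by (simp only: price_at_add_length diff_self)
  finally show ?thesis .
qed

end

section \<open>The gain function\<close>

lemma finite_set_gap:
  fixes P :: "real set"
  assumes "finite P"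
  shows "\<exists>\<delta>>0. \<forall>x\<in>P. \<forall>y\<in>P. x < y \<longrightarrow> \<delta> \<le> y - x"
proof -
  define D where "D = {z \<in> (\<lambda>(x, y). y - x) ` (P \<times> P). z > 0}"
  have D: "finite D" "\<And>z. z \<in> D \<Longrightarrow> z > 0" using assms by (auto simp: D_def)
  \<comment> \<open>The inserted 1 covers the case that \<open>P\<close> has no two distinct prices
    and \<open>D\<close> is empty.\<close>
  have "Min (insert 1 D) \<le> y - x" if "x \<in> P" "y \<in> P" "x < y" for x y
  proof (rule Min_le)
    show "y - x \<in> insert 1 D" using that by (force simp: D_def)
  qed (use D in simp)
  moreover have "Min (insert 1 D) > 0" using D by (subst Min_gr_iff) auto
  ultimately show ?thesis by blast
qed

text \<open>Distinctness turns equal predecessor prices into equal positions modulo the length. This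
  makes the successor relation of \<open>\<rho>\<close> functional.\<close>

lemma successor_unique:
  assumes "distinct \<rho>" "i < length \<rho>" "j < length \<rho>"
    and "price_at \<rho> (int i - 1) = price_at \<rho> (int j - 1)"
  shows "i = j"
proof -
  let ?d = "int (length \<rho>)"
  have d: "?d > 0" using assms(2) by linarith
  have "nat ((int i - 1) mod ?d) = nat ((int j - 1) mod ?d)"
    using assms(1,4) d by (simp add: price_at_def nth_eq_iff_index_eq nat_less_iff)
  then have "(int i - 1) mod ?d = (int j - 1) mod ?d"
    using d by (simp only: eq_nat_nat_iff pos_mod_sign)
  then have "(int i - 1 + 1) mod ?d = (int j - 1 + 1) mod ?d" by (rule mod_add_cong) simp
  then show ?thesis using assms(2,3) by simp
qed

theorem theorem4p10:
  fixes P :: "real set" and \<rho> :: "real list" and l :: nat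
  assumes "finite P" and "P \<noteq> {}"
    and "\<rho> \<noteq> []" and "distinct \<rho>" and "set \<rho> \<subseteq> P"
    and "l \<ge> 1"
  shows "\<exists>g :: real \<Rightarrow> real \<Rightarrow> real.
           reference_monotone P g \<and> unique_optimal_cycle P l g (expanded_cycle l \<rho>)"
proof -
  note l = \<open>l \<ge> 1\<close> and \<rho> = \<open>\<rho> \<noteq> []\<close>
  let ?\<tau> = "expanded_cycle l \<rho>"
  obtain \<delta> where \<delta>: "\<delta> > 0" "\<And>x y. x \<in> P \<Longrightarrow> y \<in> P \<Longrightarrow> x < y \<Longrightarrow> \<delta> \<le> y - x"
    using finite_set_gap[OF \<open>finite P\<close>] by blast
  define E where "E = {(price_at \<rho> (int i - 1), price_at \<rho> (int i)) | i. i < length \<rho>}"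
  \<comment> \<open>Raising the reference price within \<open>P\<close> gains at least
    \<open>\<delta> / l\<close>, which makes up for possibly leaving \<open>E\<close> and incurring
    the penalty.\<close>
  define \<epsilon> where "\<epsilon> = \<delta> / real l"
  define g where "g r p = base_gain l r p - \<epsilon> * of_bool ((r, p) \<notin> E)" for r p
  have \<epsilon>: "\<epsilon> > 0" using \<delta> l by (simp add: \<epsilon>_def)
  have functional: "p = q" if "(r, p) \<in> E" "(r, q) \<in> E" for r p q
    using that successor_unique[OF \<open>distinct \<rho>\<close>] by (auto simp: E_def)
  have "reference_monotone P g"
    unfolding reference_monotone_def
  proof (intro ballI mono_onI)
    fix p r s assume "r \<in> P" "s \<in> P" "r \<le> s"
    show "g r p \<le> g s p"
    proof (cases "r = s")
      case False
      then have "\<delta> / real l \<le> (s - r) / real l"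
        using \<delta>(2) \<open>r \<in> P\<close> \<open>s \<in> P\<close> \<open>r \<le> s\<close> by (intro divide_right_mono) auto
      then show ?thesis
        using base_gain_increment[OF l \<open>r \<le> s\<close>, of p] \<epsilon>
        by (auto simp: g_def \<epsilon>_def of_bool_def)
    qed simp
  qed
  moreover have \<tau>E: "(reference_price l ?\<tau> t, price_at ?\<tau> t) \<in> E" for t
    using expanded_cycle_transition[OF l \<rho>, of t] by (auto simp: E_def)
  have "(\<Sum>t<length ?\<tau>. g (reference_price l ?\<tau> (int t)) (?\<tau> ! t))
      = (\<Sum>t<length ?\<tau>. base_gain l (reference_price l ?\<tau> (int t)) (?\<tau> ! t))"
    using \<tau>E price_at_nth[of _ ?\<tau>] by (intro sum.cong refl) (auto simp: g_def, metis)
  then have \<tau>0: "objective l g ?\<tau> = 0"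
    by (simp add: objective_def sum_base_gain_expanded_cycle[OF l \<rho>])
  have \<tau>cycle: "price_cycle P ?\<tau>"
    using expanded_cycle_not_Nil[OF l \<rho>] set_expanded_cycle[OF l \<rho>] \<open>set \<rho> \<subseteq> P\<close>
    by (auto simp: price_cycle_def)
  \<comment> \<open>Dropping the nonpositive total base gain leaves only the penalties.\<close>
  have sum_le: "(\<Sum>t<length \<sigma>. g (reference_price l \<sigma> (int t)) (\<sigma> ! t))
      \<le> - \<epsilon> * (\<Sum>t<length \<sigma>. of_bool ((reference_price l \<sigma> (int t), \<sigma> ! t) \<notin> E))" for \<sigma>
    using sum_base_gain_nonpos[OF l, of \<sigma>] by (simp add: g_def sum_subtractf sum_distrib_left)
  have le0: "objective l g \<sigma> \<le> 0" for \<sigma>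
  proof -
    have "- \<epsilon> * (\<Sum>t<length \<sigma>. of_bool ((reference_price l \<sigma> (int t), \<sigma> ! t) \<notin> E)) \<le> 0"
      using \<epsilon> by (simp add: sum_nonneg)
    then show ?thesis using sum_le[of \<sigma>] unfolding objective_def
      by (intro mult_nonneg_nonpos) auto
  qed
  moreover have "same_cycle \<sigma> ?\<tau>" if opt: "optimal_cycle P l g \<sigma>" for \<sigma>
  proof -
    let ?a = "price_at \<sigma>" and ?b = "price_at ?\<tau>"
    have \<sigma>: "\<sigma> \<noteq> []" using opt by (simp add: optimal_cycle_def price_cycle_def)
    then have len: "int (length \<sigma>) > 0" by simp
    \<comment> \<open>The expanded cycle attains 0, so an optimal cycle has value at least 0, which
      forces its number of penalised steps to be 0.\<close>
    have "objective l g \<sigma> \<ge> 0"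
      using opt \<tau>0 \<tau>cycle by (auto simp: optimal_cycle_def)
    then have "(\<Sum>t<length \<sigma>. g (reference_price l \<sigma> (int t)) (\<sigma> ! t)) \<ge> 0"
      using len by (simp add: objective_def zero_le_divide_iff)
    then have "\<epsilon> * (\<Sum>t<length \<sigma>. of_bool ((reference_price l \<sigma> (int t), \<sigma> ! t) \<notin> E)) \<le> 0"
      using sum_le[of \<sigma>] by linarith
    then have "(\<Sum>t<length \<sigma>. of_bool ((reference_price l \<sigma> (int t), \<sigma> ! t) \<notin> E)) \<le> (0::real)"
      using \<epsilon> by (simp add: mult_le_0_iff)
    then have "(\<Sum>t<length \<sigma>. of_bool ((reference_price l \<sigma> (int t), \<sigma> ! t) \<notin> E)) = (0::real)"
      by (intro antisym sum_nonneg) auto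
    then have E_nth: "(reference_price l \<sigma> (int t), \<sigma> ! t) \<in> E" if "t < length \<sigma>" for t
      using that by (subst (asm) sum_nonneg_eq_0_iff) auto
    have \<sigma>E: "(recent_min ?a t l, ?a t) \<in> E" for t
    proof -
      define s where "s = nat (t mod int (length \<sigma>))"
      have s: "s < length \<sigma>" "t = int s + (t div int (length \<sigma>)) * int (length \<sigma>)"
        using len by (auto simp: s_def nat_less_iff)
      have "recent_min ?a t l = recent_min ?a (int s) l"
        by (subst s(2)) (rule recent_min_periodic, rule price_at_add_mult_length)
      moreover have "?a t = \<sigma> ! s" by (simp add: s_def price_at_def)
      ultimately show ?thesis using E_nth[OF s(1)] by (simp add: reference_price_eq_recent_min)
    qed
    \<comment> \<open>At time \<open>t\<close>, just after a global minimum of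
      \<open>\<sigma>\<close>, the last price is a record.\<close>
    obtain s where s: "s < length \<sigma>" "\<sigma> ! s = Min (set \<sigma>)"
      using \<sigma> by (metis List.finite_set Min_in in_set_conv_nth set_empty)
    define t where "t = int s + 1"
    have at: "?a (t - 1) = Min (set \<sigma>)" using s by (simp add: t_def price_at_nth)
    have ra: "recent_min ?a t l = ?a (t - 1)"
      using l price_at_in_set[OF \<sigma>] at by (intro recent_min_eqI[of _ _ "t - 1"]) auto
    \<comment> \<open>The step at \<open>t - 1\<close> is not penalised, so this minimum is itself a
      price of \<open>\<rho>\<close>.\<close>
    obtain i where i: "i < length \<rho>" "?a (t - 1) = price_at \<rho> (int i)"
      using \<sigma>E[of "t - 1"] by (auto simp: E_def)
    \<comment> \<open>The time right after a block of that price; the extra period meets the index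
      bound of \<open>record_before_block\<close>.\<close>
    define u where "u = int (block_start l \<rho> (Suc (i + length \<rho>)))"
    have bu: "?b (u - 1) = ?a (t - 1)"
      using price_at_before_block[OF l \<rho>, of "i + length \<rho>"] i(2) by (simp add: u_def)
    have rb: "recent_min ?b u l = ?b (u - 1)"
      using record_before_block[OF l \<rho>, of "i + length \<rho>"] bu i(2) by (simp add: u_def)
    have "?a (t + int n) = ?b (u + int n)" for n
      by (rule determined_by_record[OF l functional \<sigma>E _ ra rb])
         (use \<tau>E bu in \<open>auto simp: reference_price_eq_recent_min\<close>)
    then show ?thesis by (intro same_cycleI[OF \<sigma> expanded_cycle_not_Nil[OF l \<rho>]])
  qed
  ultimately have "unique_optimal_cycle P l g ?\<tau>"
    using \<tau>0 \<tau>cycle by (simp add: unique_optimal_cycle_def optimal_cycle_def)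
  then show ?thesis using \<open>reference_monotone P g\<close> by blast
qed

end
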